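(* Let $E$ be a separable Hilbert space of functions from $K=[0,x^\star)\subset\mathbb{R}_+$ (a bounded interval) to $\mathbb{R}$, with inner product $\langle\cdot,\cdot\rangle$, such that $$ (Jf)(x):=\frac{1}{x}\int_0^x f(z)\,dz,\qquad (Tf)(x):=x\,\frac{d}{dx}f(x) $$ define bounded linear operators $J,T:E\to E$. Let $\Lambda:=I_d+T$, where $I_d$ is the identity operator on $E$. Let $(r_t)_{t\in\mathbb{N}}$ (the forward rate curves) and $(y_t)_{t\in\mathbb{N}}$ (the yield curves) be square-integrable weakly stationary $E$-valued discrete-time processes related by $y_t=J r_t$, equivalently $r_t=\Lambda y_t$, for every $t\in\mathbb{N}$. Let $Q_r$ and $Q_y$ be their covariance operators on $E$, and assume that $Q_r$ and $Q_y$ have finite rank. Then $$ Q_r=\Lambda Q_y\Lambda^*\qquad\text{and}\qquad Q_y=J Q_r J^*, $$ where $*$ denotes the Hilbert space adjoint. In particular, $\operatorname{Rank} Q_r=\operatorname{Rank} Q_y$.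
   Context: Time is discrete, $t\in\mathbb{N}=\{0,1,2,\dots\}$. The forward rate curve $r_t$ and the yield curve $y_t$ at time $t$ are functions of time to maturity $x\in K$, connected by $y_t(x)=\frac1x\int_0^x r_t(z)\,dz$, i.e. $y_t=Jr_t$; inverting this gives $r_t(x)=y_t(x)+x\,\frac{\partial y_t}{\partial x}(x)$, i.e. $r_t=\Lambda y_t$. At $x=0$ the expression $\frac1x\int_0^x f(z)\,dz$ is understood as its limit. Square-integrable: $\mathbb{E}\|r_t\|^2<\infty$ and $\mathbb{E}\|y_t\|^2<\infty$ for all $t$, where $\|\cdot\|$ is the norm of $E$. Weakly stationary: the mean functions $\mu_r(u)=\mathbb{E}\,r_t(u)$, $\mu_y(u)=\mathbb{E}\,y_t(u)$ and the covariance kernels $\mathrm{Cov}(r_t(u),r_t(v))$, $\mathrm{Cov}(y_t(u),y_t(v))$, $u,v\in K$, do not depend on $t$; accordingly the means $\mu_r,\mu_y\in E$ and the covariance operators below do not depend on $t$. Covariance operators: $Q_r$ and $Q_y$ are the unique self-adjoint, non-negative, bounded operators on $E$ such that, for all $f,g\in E$ and all $t\in\mathbb{N}$, $$\langle Q_r f,g\rangle=\mathbb{E}\big[\langle r_t-\mu_r,f\rangle\langle r_t-\mu_r,g\rangle\big],\qquad \langle Q_y f,g\rangle=\mathbb{E}\big[\langle y_t-\mu_y,f\rangle\langle y_t-\mu_y,g\rangle\big].$$ *)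

theory Defs
  imports "HOL-Probability.Probability_Measure"
begin

(* A Hilbert space of functions from K to the reals is given by a Hilbert space 'e together with
   the map val that sends an element of 'e to the function it stands for: val is linear and
   injective for functions on K; the values of val f outside K are irrelevant.
   Continuity of the point evaluations is not part of the notion. *)
definition function_space_on :: "real set \<Rightarrow> ('e::real_vector \<Rightarrow> real \<Rightarrow> real) \<Rightarrow> bool" where
  "function_space_on K val \<longleftrightarrow>
     (\<forall>f g. \<forall>x\<in>K. val (f + g) x = val f x + val g x) \<and>
     (\<forall>c f. \<forall>x\<in>K. val (c *\<^sub>R f) x = c * val f x) \<and>
     (\<forall>f g. (\<forall>x\<in>K. val f x = val g x) \<longrightarrow> f = g)"

definition running_average :: "(real \<Rightarrow> real) \<Rightarrow> real \<Rightarrow> real" where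
  "running_average h x = 1 / x * (LINT z:{0..x}|lborel. h z)"

(* At x = 0 the average is read as its limit. *)
definition is_averaging_op ::
  "real set \<Rightarrow> ('e::real_normed_vector \<Rightarrow> real \<Rightarrow> real) \<Rightarrow> ('e \<Rightarrow> 'e) \<Rightarrow> bool" where
  "is_averaging_op K val J \<longleftrightarrow> bounded_linear J \<and>
     (\<forall>f. (\<forall>x\<in>K. 0 < x \<longrightarrow>
             set_integrable lborel {0..x} (val f) \<and> val (J f) x = running_average (val f) x) \<and>
          (running_average (val f) \<longlongrightarrow> val (J f) 0) (at_right 0))"

(* The derivative is taken within K, hence is one-sided at 0. *)
definition is_weighted_derivative_op ::
  "real set \<Rightarrow> ('e::real_normed_vector \<Rightarrow> real \<Rightarrow> real) \<Rightarrow> ('e \<Rightarrow> 'e) \<Rightarrow> bool" where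
  "is_weighted_derivative_op K val T \<longleftrightarrow> bounded_linear T \<and>
     (\<forall>f. \<forall>x\<in>K. \<exists>D. (val f has_real_derivative D) (at x within K) \<and> val (T f) x = x * D)"

definition Lambda_op :: "('e::real_vector \<Rightarrow> 'e) \<Rightarrow> 'e \<Rightarrow> 'e" where
  "Lambda_op T = (\<lambda>f. f + T f)"

definition square_integrable_process ::
  "'w measure \<Rightarrow> (nat \<Rightarrow> 'w \<Rightarrow> 'e::real_normed_vector) \<Rightarrow> bool" where
  "square_integrable_process M X \<longleftrightarrow>
     (\<forall>t. X t \<in> borel_measurable M \<and> integrable M (\<lambda>\<omega>. (norm (X t \<omega>))\<^sup>2))"

definition covariance :: "'w measure \<Rightarrow> ('w \<Rightarrow> real) \<Rightarrow> ('w \<Rightarrow> real) \<Rightarrow> real" where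
  "covariance M A B = (LINT \<omega>|M. (A \<omega> - (LINT \<omega>'|M. A \<omega>')) * (B \<omega> - (LINT \<omega>'|M. B \<omega>')))"

(* The first condition makes the moments below meaningful; as the point evaluations need not be
   continuous, it is not a consequence of square integrability in 'e. *)
definition weakly_stationary ::
  "'w measure \<Rightarrow> real set \<Rightarrow> ('e \<Rightarrow> real \<Rightarrow> real) \<Rightarrow> (nat \<Rightarrow> 'w \<Rightarrow> 'e) \<Rightarrow> bool" where
  "weakly_stationary M K val X \<longleftrightarrow>
     (\<forall>t. \<forall>u\<in>K. (\<lambda>\<omega>. val (X t \<omega>) u) \<in> borel_measurable M \<and>
                 integrable M (\<lambda>\<omega>. (val (X t \<omega>) u)\<^sup>2)) \<and>
     (\<forall>s t. \<forall>u\<in>K. (LINT \<omega>|M. val (X s \<omega>) u) = (LINT \<omega>|M. val (X t \<omega>) u)) \<and>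
     (\<forall>s t. \<forall>u\<in>K. \<forall>v\<in>K. covariance M (\<lambda>\<omega>. val (X s \<omega>) u) (\<lambda>\<omega>. val (X s \<omega>) v)
                            = covariance M (\<lambda>\<omega>. val (X t \<omega>) u) (\<lambda>\<omega>. val (X t \<omega>) v))"

(* The mean is the Bochner expectation in 'e, and as a function on K it is the pointwise
   expectation; for continuous point evaluations the second follows from the first. *)
definition is_mean ::
  "'w measure \<Rightarrow> real set \<Rightarrow> ('e::{real_normed_vector, banach, second_countable_topology} \<Rightarrow> real \<Rightarrow> real)
    \<Rightarrow> (nat \<Rightarrow> 'w \<Rightarrow> 'e) \<Rightarrow> 'e \<Rightarrow> bool" where
  "is_mean M K val X \<mu> \<longleftrightarrow>
     (\<forall>t. (LINT \<omega>|M. X t \<omega>) = \<mu> \<and> (\<forall>u\<in>K. val \<mu> u = (LINT \<omega>|M. val (X t \<omega>) u)))"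

definition is_covariance_op ::
  "'w measure \<Rightarrow> (nat \<Rightarrow> 'w \<Rightarrow> 'e::real_inner) \<Rightarrow> 'e \<Rightarrow> ('e \<Rightarrow> 'e) \<Rightarrow> bool" where
  "is_covariance_op M X \<mu> Q \<longleftrightarrow> bounded_linear Q \<and>
     (\<forall>f g. Q f \<bullet> g = f \<bullet> Q g) \<and> (\<forall>f. 0 \<le> Q f \<bullet> f) \<and>
     (\<forall>t f g. Q f \<bullet> g = (LINT \<omega>|M. ((X t \<omega> - \<mu>) \<bullet> f) * ((X t \<omega> - \<mu>) \<bullet> g)))"

lemma is_covariance_op_unique:
  assumes "is_covariance_op M X \<mu> Q" and "is_covariance_op M X \<mu> Q'"
  shows "Q = Q'"
proof
  fix f
  have "Q f \<bullet> g = Q' f \<bullet> g" for g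
    using assms unfolding is_covariance_op_def by metis
  then show "Q f = Q' f"
    by (metis vector_eq_rdot)
qed

definition finite_rank :: "('a \<Rightarrow> 'b::real_vector) \<Rightarrow> bool" where
  "finite_rank Q \<longleftrightarrow> (\<exists>B. finite B \<and> range Q \<subseteq> span B)"

(* Meaningful for finite-rank operators only, as dim is 0 for infinite-dimensional spaces. *)
definition op_rank :: "('a \<Rightarrow> 'b::real_vector) \<Rightarrow> nat" where
  "op_rank Q = dim (range Q)"

end

theory Submission
  imports Defs
begin

text \<open>
  The fundamental theorem of calculus gives \<open>\<Lambda> J = I\<close>: members of the space are
  differentiable on \<open>K\<close>, hence continuous, so differentiating \<open>x (J f)(x) = \<integral>\<^sub>0\<^sup>x f\<close>
  yields \<open>J f + T (J f) = f\<close>. Hence \<open>r\<^sub>t = \<Lambda> y\<^sub>t\<close> almost surely, and both covariance identities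
  are the transformation rule \<open>Q \<mapsto> A Q A\<^sup>*\<close> for the covariance of the image of a process under a
  bounded operator \<open>A\<close>. As each of the two ranges is contained in a linear image of the other one,
  the ranks agree.
\<close>

subsection \<open>Riesz representation and adjoints\<close>

text \<open>The norms obey the parallelogram law, and the linear parts cancel because \<phi> at the
  midpoint averages its values at \<open>a\<close> and \<open>b\<close>. This makes minimising
  sequences of \<open>F\<close> Cauchy.\<close>

lemma square_minus_linear_parallelogram:
  fixes a b :: "'a::real_inner" and \<phi> :: "'a \<Rightarrow> real"
  assumes "linear \<phi>"
  defines "F \<equiv> \<lambda>x. (norm x)\<^sup>2 - 2 * \<phi> x"
  shows "(norm (a - b))\<^sup>2 = 2 * F a + 2 * F b - 4 * F ((1/2) *\<^sub>R (a + b))"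
proof -
  have "\<phi> ((1/2) *\<^sub>R (a + b)) = (\<phi> a + \<phi> b) / 2"
    by (simp add: linear_add[OF assms(1)] linear_cmul[OF assms(1)])
  then show ?thesis
    unfolding F_def power2_norm_eq_inner
    by (simp add: algebra_simps inner_commute)
qed

text \<open>The representing vector is the minimiser of \<open>\<parallel>x\<parallel>\<^sup>2 - 2 \<phi> x\<close>.\<close>

theorem riesz_representation:
  fixes \<phi> :: "'a::{real_inner, banach} \<Rightarrow> real"
  assumes "bounded_linear \<phi>"
  obtains u where "\<And>x. \<phi> x = u \<bullet> x"
proof -
  interpret \<phi>: bounded_linear \<phi> by fact
  define F where "F x = (norm x)\<^sup>2 - 2 * \<phi> x" for x
  obtain C where C: "\<And>x. norm (\<phi> x) \<le> norm x * C"
    using \<phi>.bounded by blast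
  have lower: "- C\<^sup>2 \<le> F x" for x
  proof -
    \<comment> \<open>Completing the square in \<open>norm x\<close> after replacing
      \<open>\<phi> x\<close> by its bound \<open>norm x * C\<close>.\<close>
    have "0 \<le> (norm x - C)\<^sup>2" by simp
    moreover have "\<phi> x \<le> norm x * C" using C[of x] by simp
    ultimately show ?thesis by (simp add: F_def power2_eq_square algebra_simps)
  qed
  then have bdd: "bdd_below (range F)" by (auto intro!: bdd_belowI)
  define m where "m = (INF x. F x)"
  have m_le: "m \<le> F x" for x
    unfolding m_def by (rule cINF_lower[OF bdd]) simp
  have "\<exists>x. F x < m + inverse (real (Suc n))" for n
    using cINF_less_iff[of UNIV F "m + inverse (real (Suc n))"] bdd by (simp add: m_def)
  then obtain s where s: "\<And>n. F (s n) < m + inverse (real (Suc n))" by metis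
  have dist_s: "(norm (s i - s j))\<^sup>2 \<le> 2 * inverse (real (Suc i)) + 2 * inverse (real (Suc j))" for i j
  proof -
    have "(norm (s i - s j))\<^sup>2 = 2 * F (s i) + 2 * F (s j) - 4 * F ((1/2) *\<^sub>R (s i + s j))"
      unfolding F_def by (rule square_minus_linear_parallelogram[OF \<phi>.linear])
    \<comment> \<open>The value of \<open>F\<close> at the midpoint is at least \<open>m\<close>,
      which leaves only the excesses of \<open>F (s i)\<close> and \<open>F (s j)\<close> over
      \<open>m\<close>.\<close>
    then show ?thesis
      using s[of i] s[of j] m_le[of "(1/2) *\<^sub>R (s i + s j)"] by linarith
  qed
  have "Cauchy s"
  proof (rule CauchyI)
    fix e :: real assume "0 < e"
    \<comment> \<open>With this bound each of the two terms in \<open>dist_s\<close> is below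
      \<open>e\<^sup>2 / 2\<close>.\<close>
    then obtain N where N: "inverse (real (Suc N)) < e\<^sup>2 / 4"
      using reals_Archimedean[of "e\<^sup>2 / 4"] by auto
    have "norm (s i - s j) < e" if "N \<le> i" "N \<le> j" for i j
    proof -
      have "inverse (real (Suc i)) \<le> inverse (real (Suc N))"
        "inverse (real (Suc j)) \<le> inverse (real (Suc N))"
        using that by (auto intro!: le_imp_inverse_le)
      then have "(norm (s i - s j))\<^sup>2 < e\<^sup>2"
        using dist_s[of i j] N by linarith
      then show ?thesis using \<open>0 < e\<close> by (simp add: power_less_imp_less_base)
    qed
    then show "\<exists>N. \<forall>i\<ge>N. \<forall>j\<ge>N. norm (s i - s j) < e" by blast
  qed
  then obtain u where u: "s \<longlonglongrightarrow> u"
    by (meson Cauchy_convergent_iff convergent_def)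
  have "(\<lambda>n. F (s n)) \<longlonglongrightarrow> F u"
    unfolding F_def by (intro tendsto_intros \<phi>.tendsto u)
  moreover have "(\<lambda>n. m + inverse (real (Suc n))) \<longlonglongrightarrow> m + 0"
    by (intro tendsto_intros LIMSEQ_inverse_real_of_nat)
  ultimately have "F u \<le> m + 0"
    by (rule LIMSEQ_le) (use s in \<open>auto intro: less_imp_le\<close>)
  then have min: "F u \<le> F x" for x using m_le[of x] by simp
  have "\<phi> v = u \<bullet> v" for v
  proof (cases "v = 0")
    case False
    define d where "d = u \<bullet> v - \<phi> v"
    \<comment> \<open>The minimiser of the quadratic \<open>F (u + t *\<^sub>R v)\<close> in
      \<open>t\<close>; unless \<open>d = 0\<close>, it would push \<open>F\<close> below its
      minimum \<open>F u\<close>.\<close>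
    define t where "t = - d / (v \<bullet> v)"
    have vv: "0 < v \<bullet> v" using False by simp
    have "F (u + t *\<^sub>R v) = F u + 2 * t * d + t\<^sup>2 * (v \<bullet> v)"
      unfolding F_def d_def power2_norm_eq_inner
      by (simp add: \<phi>.add \<phi>.scaleR algebra_simps inner_commute power2_eq_square)
    also have "\<dots> = F u - d\<^sup>2 / (v \<bullet> v)"
      using vv by (simp add: t_def field_simps power2_eq_square)
    finally have "d\<^sup>2 / (v \<bullet> v) \<le> 0" using min[of "u + t *\<^sub>R v"] by simp
    then have "d = 0" using vv by (simp add: divide_le_0_iff)
    then show ?thesis by (simp add: d_def)
  qed (simp add: \<phi>.zero)
  then show thesis using that by blast
qed

text \<open>The library proves this only for Euclidean spaces.\<close>

lemma adjoint_works_Hilbert: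
  fixes A :: "'a::{real_inner, banach} \<Rightarrow> 'b::real_inner"
  assumes "bounded_linear A"
  shows "x \<bullet> adjoint A y = A x \<bullet> y"
proof -
  have "\<exists>u. \<forall>x. A x \<bullet> y = u \<bullet> x" for y
    using riesz_representation[OF bounded_linear_compose[OF bounded_linear_inner_left assms]]
    by metis
  then have "\<exists>A'. \<forall>x y. A x \<bullet> y = x \<bullet> A' y"
    by (metis inner_commute)
  then have "\<forall>x y. A x \<bullet> y = x \<bullet> adjoint A y"
    unfolding adjoint_def by (rule someI_ex)
  then show ?thesis by simp
qed

subsection \<open>The operators on the function space\<close>

text \<open>The fundamental theorem of calculus is applied to the gauge integral, which agrees with
  the Lebesgue integral on each \<open>{0..u}\<close> by continuity.\<close>

lemma set_lborel_integral_has_derivative: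
  fixes h :: "real \<Rightarrow> real"
  assumes cont: "continuous_on {0..b} h" and x: "x \<in> {0..b}"
  shows "((\<lambda>u. LINT z:{0..u}|lborel. h z) has_real_derivative h x) (at x within {0..b})"
proof (rule has_field_derivative_transform_within[OF _ zero_less_one x])
  show "((\<lambda>u. integral {0..u} h) has_real_derivative h x) (at x within {0..b})"
    using assms by (rule integral_has_real_derivative)
  show "integral {0..u} h = (LINT z:{0..u}|lborel. h z)" if "u \<in> {0..b}" for u
  proof (rule set_borel_integral_eq_integral(2)[symmetric])
    show "set_integrable lborel {0..u} h"
      by (rule borel_integrable_atLeastAtMost'[OF continuous_on_subset[OF cont]]) (use that in auto)
  qed
qed

text \<open>Elements are determined by their values on the interval, so a pointwise check suffices.
  For \<open>0 < x\<close> it is the product rule; at \<open>x = 0\<close> the term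
  \<open>x * D\<close> vanishes and \<open>val (J f) 0 = val f 0\<close> comes from the limit of the
  averages.\<close>

lemma Lambda_averaging:
  fixes val :: "'e::real_normed_vector \<Rightarrow> real \<Rightarrow> real"
  assumes fs: "function_space_on {0..<xs} val"
    and J: "is_averaging_op {0..<xs} val J"
    and T: "is_weighted_derivative_op {0..<xs} val T"
  shows "Lambda_op T (J f) = f"
proof -
  have cont: "continuous_on {0..b} (val g)" if "b < xs" for b g
  proof -
    have "continuous_on {0..<xs} (val g)"
      using T unfolding is_weighted_derivative_op_def continuous_on_eq_continuous_within
      by (meson DERIV_continuous)
    then show ?thesis by (rule continuous_on_subset) (use that in auto)
  qed
  have avg: "val (J f) x = running_average (val f) x" if "0 < x" "x < xs" for x
    using J that unfolding is_averaging_op_def by simp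
  have "val (J f + T (J f)) x = val f x" if x: "x \<in> {0..<xs}" for x
  proof -
    \<comment> \<open>The domain is half-open and \<open>val f\<close> may be unbounded near
      \<open>xs\<close>; on the compact interval \<open>{0..b}\<close> it is continuous.\<close>
    obtain b where b: "x < b" "b < xs" using x dense[of x xs] by auto
    define I where "I u = (LINT z:{0..u}|lborel. val f z)" for u
    obtain D where D: "(val (J f) has_real_derivative D) (at x within {0..<xs})"
      "val (T (J f)) x = x * D"
      using T x unfolding is_weighted_derivative_op_def by meson
    have I: "(I has_real_derivative val f x) (at x within {0..b})"
      unfolding I_def by (rule set_lborel_integral_has_derivative[OF cont]) (use x b in auto)
    have "val (J f) x + x * D = val f x"
    proof (cases "x = 0")
      case True
      \<comment> \<open>Since \<open>I 0 = 0\<close>, the difference quotient of \<open>I\<close> at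
        0 is the running average itself.\<close>
      have "((\<lambda>u. (I u - I 0) / (u - 0)) \<longlongrightarrow> val f 0) (at_right 0)"
        using I True b unfolding has_field_derivative_iff by (simp add: at_within_Icc_at_right)
      moreover have "I 0 = 0"
        unfolding I_def set_lebesgue_integral_def
        by (rule integral_eq_zero_AE, rule AE_mp[OF AE_lborel_singleton[of 0]])
          (auto simp: indicator_def)
      ultimately have "(running_average (val f) \<longlongrightarrow> val f 0) (at_right 0)"
        by (simp add: I_def running_average_def[abs_def])
      moreover have "(running_average (val f) \<longlongrightarrow> val (J f) 0) (at_right 0)"
        using J unfolding is_averaging_op_def by blast
      ultimately have "val (J f) 0 = val f 0"
        by (intro tendsto_unique[of "at_right (0::real)"]) auto
      then show ?thesis using True by simp
    next
      case False
      then have x0: "x \<in> {0<..<b}" using x b by auto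
      have "(val (J f) has_real_derivative D) (at x)"
        using has_field_derivative_subset[OF D(1), of "{0<..<b}"] b x0
        by (simp add: at_within_open[of x "{0<..<b}"] subset_eq)
      then have "((\<lambda>u. u * val (J f) u) has_real_derivative 1 * val (J f) x + D * x) (at x)"
        by (intro DERIV_mult DERIV_ident)
      moreover have "(I has_real_derivative val f x) (at x)"
        using has_field_derivative_subset[OF I, of "{0<..<b}"] x0
        by (simp add: at_within_open[of x "{0<..<b}"] subset_eq)
      \<comment> \<open>On \<open>{0<..<b}\<close> the factor \<open>u\<close> cancels the
        \<open>1 / u\<close> of the average, so the product is \<open>I u\<close>.\<close>
      then have "((\<lambda>u. u * val (J f) u) has_real_derivative val f x) (at x)"
        by (rule has_field_derivative_transform_within_open[of _ _ _ "{0<..<b}"])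
          (use x0 b avg in \<open>auto simp: I_def running_average_def\<close>)
      ultimately have "1 * val (J f) x + D * x = val f x" by (rule DERIV_unique)
      then show ?thesis by (simp add: mult.commute)
    qed
    moreover have "val (J f + T (J f)) x = val (J f) x + val (T (J f)) x"
      using fs x unfolding function_space_on_def by blast
    ultimately show ?thesis using D(2) by simp
  qed
  then show ?thesis
    using fs unfolding function_space_on_def Lambda_op_def by blast
qed

subsection \<open>Covariance operators under linear maps\<close>

text \<open>Moving \<open>A\<close> across the inner product turns the second moments of
  \<open>Y\<close> at \<open>f\<close>, \<open>g\<close> into those of \<open>X\<close> at
  \<open>adjoint A f\<close>, \<open>adjoint A g\<close>; null sets do not affect the
  integrals.\<close>

lemma covariance_op_transform:
  fixes X :: "nat \<Rightarrow> 'w \<Rightarrow> 'a::{real_inner, banach, second_countable_topology}"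
    and Y :: "nat \<Rightarrow> 'w \<Rightarrow> 'b::{real_inner, second_countable_topology}"
  assumes A: "bounded_linear A"
    and X: "\<And>t. X t \<in> borel_measurable M"
    and Y: "\<And>t. Y t \<in> borel_measurable M"
    and Y_eq: "\<And>t. AE \<omega> in M. Y t \<omega> = A (X t \<omega>)"
    and QX: "is_covariance_op M X \<mu> Q"
    and QY: "is_covariance_op M Y (A \<mu>) Q'"
  shows "Q' = A \<circ> Q \<circ> adjoint A"
proof
  fix f
  have "Q' f \<bullet> g = (A \<circ> Q \<circ> adjoint A) f \<bullet> g" for g
  proof -
    let ?A = "adjoint A"
    have "Q' f \<bullet> g = (LINT \<omega>|M. ((Y 0 \<omega> - A \<mu>) \<bullet> f) * ((Y 0 \<omega> - A \<mu>) \<bullet> g))"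
      using QY unfolding is_covariance_op_def by blast
    also have "\<dots> = (LINT \<omega>|M. ((X 0 \<omega> - \<mu>) \<bullet> ?A f) * ((X 0 \<omega> - \<mu>) \<bullet> ?A g))"
    proof (rule integral_cong_AE)
      show "AE \<omega> in M. ((Y 0 \<omega> - A \<mu>) \<bullet> f) * ((Y 0 \<omega> - A \<mu>) \<bullet> g)
        = ((X 0 \<omega> - \<mu>) \<bullet> ?A f) * ((X 0 \<omega> - \<mu>) \<bullet> ?A g)"
        using Y_eq[of 0]
        by eventually_elim (simp add: adjoint_works_Hilbert[OF A] linear_diff[OF bounded_linear.linear[OF A]])
    qed (use X Y in measurable)
    also have "\<dots> = Q (?A f) \<bullet> ?A g"
      using QX unfolding is_covariance_op_def by metis
    also have "\<dots> = A (Q (?A f)) \<bullet> g" by (rule adjoint_works_Hilbert[OF A])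
    finally show ?thesis by simp
  qed
  then show "Q' f = (A \<circ> Q \<circ> adjoint A) f" by (metis vector_eq_rdot)
qed

text \<open>Precomposing with \<open>B\<close> can only shrink the range, and \<open>A\<close> maps
  a basis of the span of \<open>range Q\<close> to a spanning set. Finite rank excludes the default
  value 0 of \<open>dim\<close>, for which the bound could fail.\<close>

lemma op_rank_compose_le:
  fixes A :: "'b::real_vector \<Rightarrow> 'c::real_vector" and Q :: "'a \<Rightarrow> 'b"
  assumes A: "linear A" and Q: "finite_rank Q"
  shows "op_rank (A \<circ> Q \<circ> B) \<le> op_rank Q"
proof -
  obtain b where b: "b \<subseteq> range Q" "independent b" "range Q \<subseteq> span b" "card b = dim (range Q)"
    by (rule basis_exists)
  obtain c where c: "finite c" "range Q \<subseteq> span c" using Q unfolding finite_rank_def by blast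
  have "finite b"
    using independent_span_bound[OF c(1) b(2)] b(1) c(2) by blast
  have "range (A \<circ> Q \<circ> B) \<subseteq> A ` span b" using b(3) by auto
  then have "range (A \<circ> Q \<circ> B) \<subseteq> span (A ` b)"
    by (simp add: linear_span_image[OF A])
  then have "dim (range (A \<circ> Q \<circ> B)) \<le> card (A ` b)"
    by (rule dim_le_card) (simp add: \<open>finite b\<close>)
  also have "\<dots> \<le> card b" by (rule card_image_le[OF \<open>finite b\<close>])
  finally show ?thesis by (simp add: op_rank_def b(4))
qed

text \<open>On a probability space constants are integrable, so
  \<open>1 + (norm (X t \<omega>))\<^sup>2\<close> is an integrable bound for the norm.\<close>

lemma square_integrable_process_integrable:
  fixes X :: "nat \<Rightarrow> 'w \<Rightarrow> 'e::{banach, second_countable_topology}"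
  assumes "prob_space M" and "square_integrable_process M X"
  shows "integrable M (X t)"
proof -
  interpret prob_space M by fact
  have X: "X t \<in> borel_measurable M" "integrable M (\<lambda>\<omega>. (norm (X t \<omega>))\<^sup>2)"
    using assms(2) unfolding square_integrable_process_def by auto
  have le: "norm (X t \<omega>) \<le> 1 + (norm (X t \<omega>))\<^sup>2" for \<omega>
  proof -
    have "0 \<le> (norm (X t \<omega>) - 1)\<^sup>2" by simp
    then have "2 * norm (X t \<omega>) \<le> 1 + (norm (X t \<omega>))\<^sup>2" by (simp add: power2_diff)
    then show ?thesis using norm_ge_zero[of "X t \<omega>"] by linarith
  qed
  show ?thesis
    by (rule Bochner_Integration.integrable_bound[of M "\<lambda>\<omega>. 1 + (norm (X t \<omega>))\<^sup>2"])
      (use X le in auto)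
qed

theorem proposition2p1:
  fixes M :: "'w measure"
    and xs :: real
    and val :: "'e::{real_inner, banach, second_countable_topology} \<Rightarrow> real \<Rightarrow> real"
    and J T :: "'e \<Rightarrow> 'e"
    and r y :: "nat \<Rightarrow> 'w \<Rightarrow> 'e"
    and \<mu>r \<mu>y :: 'e
    and Qr Qy :: "'e \<Rightarrow> 'e"
  assumes "prob_space M"
    and "0 < xs"
    and "function_space_on {0..<xs} val"
    and "is_averaging_op {0..<xs} val J"
    and "is_weighted_derivative_op {0..<xs} val T"
    and "square_integrable_process M r"
    and "square_integrable_process M y"
    and "weakly_stationary M {0..<xs} val r"
    and "weakly_stationary M {0..<xs} val y"
    and "\<And>t. AE \<omega> in M. y t \<omega> = J (r t \<omega>)"
    and "is_mean M {0..<xs} val r \<mu>r"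
    and "is_mean M {0..<xs} val y \<mu>y"
    and "is_covariance_op M r \<mu>r Qr"
    and "is_covariance_op M y \<mu>y Qy"
    and "finite_rank Qr"
    and "finite_rank Qy"
  shows "Qr = Lambda_op T \<circ> Qy \<circ> adjoint (Lambda_op T)
       \<and> Qy = J \<circ> Qr \<circ> adjoint J
       \<and> op_rank Qr = op_rank Qy"
proof -
  have J: "bounded_linear J" and T: "bounded_linear T"
    using assms(4,5) unfolding is_averaging_op_def is_weighted_derivative_op_def by auto
  have \<Lambda>: "bounded_linear (Lambda_op T)"
    unfolding Lambda_op_def using T by (intro bounded_linear_add bounded_linear_ident)
  have \<Lambda>J: "Lambda_op T (J f) = f" for f
    using assms(3-5) by (rule Lambda_averaging)
  have r: "r t \<in> borel_measurable M" and y: "y t \<in> borel_measurable M" for t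
    using assms(6,7) unfolding square_integrable_process_def by auto
  \<comment> \<open>Bounded operators commute with the Bochner integral, so the centring vectors
    correspond under \<open>J\<close>, as \<open>covariance_op_transform\<close> demands.\<close>
  have "\<mu>y = (LINT \<omega>|M. y 0 \<omega>)"
    using assms(12) unfolding is_mean_def by simp
  also have "\<dots> = (LINT \<omega>|M. J (r 0 \<omega>))"
    by (rule integral_cong_AE)
      (use assms(10) y borel_measurable_continuous_on[OF linear_continuous_on[OF J] r] in auto)
  also have "\<dots> = J (LINT \<omega>|M. r 0 \<omega>)"
    by (rule integral_bounded_linear[OF J square_integrable_process_integrable[OF assms(1,6)]])
  also have "\<dots> = J \<mu>r"
    using assms(11) unfolding is_mean_def by simp
  finally have \<mu>y: "\<mu>y = J \<mu>r" .
  have "AE \<omega> in M. r t \<omega> = Lambda_op T (y t \<omega>)" for t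
    using assms(10)[of t] by eventually_elim (simp add: \<Lambda>J)
  \<comment> \<open>Applying \<Lambda> to \<open>\<mu>y = J \<mu>r\<close> gives
    \<open>\<mu>r\<close> back, so the transformation rule also runs from \<open>y\<close> to
    \<open>r\<close>.\<close>
  moreover have "is_covariance_op M r (Lambda_op T \<mu>y) Qr"
    using assms(13) by (simp add: \<mu>y \<Lambda>J)
  ultimately have Qr: "Qr = Lambda_op T \<circ> Qy \<circ> adjoint (Lambda_op T)"
    using covariance_op_transform[where X = y and Y = r, OF \<Lambda> y r _ assms(14)] by blast
  have Qy: "Qy = J \<circ> Qr \<circ> adjoint J"
    using covariance_op_transform[where X = r and Y = y, OF J r y assms(10,13)] assms(14) \<mu>y by blast
  have "op_rank Qr \<le> op_rank Qy"
    by (subst Qr) (rule op_rank_compose_le[OF bounded_linear.linear[OF \<Lambda>] assms(16)])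
  moreover have "op_rank Qy \<le> op_rank Qr"
    by (subst Qy) (rule op_rank_compose_le[OF bounded_linear.linear[OF J] assms(15)])
  ultimately show ?thesis by (intro conjI Qr Qy antisym)
qed

end
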